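(* Let $\psi$ and $\tilde\psi$ be $C^1$ maps such that $\psi,\tilde\psi$ and their gradients (Jacobians) are polynomially bounded, and $\psi,\tilde\psi$ satisfy polynomial generalized continuity and polynomial generalized smoothness. Then, whenever the following operations are evaluated on compatible domains, each of 1. $\psi(w)+\tilde\psi(w)$, where $\psi,\tilde\psi:\mathbb{R}^d\to\mathbb{R}^m$; 2. $\psi(w)\tilde\psi(w)$ (matrix product), where $\psi(w)\in\mathbb{R}^{m\times d}$ and $\tilde\psi(w)\in\mathbb{R}^{d\times n}$; 3. $(\psi\circ\tilde\psi)(w)$, where $\psi:\mathbb{R}^d\to\mathbb{R}^m$ and $\tilde\psi:\mathbb{R}^n\to\mathbb{R}^d$; satisfies the same properties (polynomial boundedness of the function and of its gradient, polynomial generalized continuity, and polynomial generalized smoothness), with possibly different polynomials.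
   Context: $\|\cdot\|$ is the $\ell^2$ norm of vectors and matrices. Let $\psi:\Omega\subseteq\mathbb{R}^n\to\mathbb{R}^d$, with variable $w$ split into blocks $w_1,\dots,w_{n_w}$, $w_i\in\mathbb{R}^{n_{i,1}\times n_{i,2}}$, $n=\sum_i n_{i,1}n_{i,2}$. Below $S$ denotes a polynomial all of whose coefficients are positive. Polynomially bounded: there is $S$ with $\|\psi(w)\|\le S(\|w_1\|,\dots,\|w_{n_w}\|)$ for all $w\in\Omega$. Polynomial generalized continuity: there is $S$ with $\|\psi(w)-\psi(w')\|\le S(\|w_{\max,1}\|,\dots,\|w_{\max,n_w}\|)\|w-w'\|$ for all $w,w'\in\Omega$, where $\|w_{\max,i}\|=\max\{\|w_i\|,\|w'_i\|\}$. Polynomial generalized smoothness: $\psi\in C^1$ and $\nabla\psi$ satisfies polynomial generalized continuity. For matrix-valued maps, gradients are taken after vectorization. *)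

theory Defs
  imports "HOL-Analysis.Analysis" "HOL-Library.Poly_Mapping"
begin

text \<open>
  Polynomials are finitely supported maps from monomials (themselves finitely supported maps from
  variable indices to exponents) to coefficients. The coefficients of a polynomial are those of the
  monomials that occur in it, i.e. of the elements of its \<open>keys\<close>.
\<close>

type_synonym real_mpoly = "(nat \<Rightarrow>\<^sub>0 nat) \<Rightarrow>\<^sub>0 real"

definition mpoly_eval :: "real_mpoly \<Rightarrow> (nat \<Rightarrow> real) \<Rightarrow> real" where
  "mpoly_eval S x = (\<Sum>m\<in>Poly_Mapping.keys S. Poly_Mapping.lookup S m *
     (\<Prod>i\<in>Poly_Mapping.keys m. x i ^ Poly_Mapping.lookup m i))"

definition pos_mpoly :: "nat \<Rightarrow> real_mpoly \<Rightarrow> bool" where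
  "pos_mpoly k S \<longleftrightarrow>
     (\<forall>m\<in>Poly_Mapping.keys S. Poly_Mapping.lookup S m > 0 \<and> Poly_Mapping.keys m \<subseteq> {..<k})"

text \<open>
  A block structure on vectors \<open>w :: real ^ 'n\<close> has \<open>nblocks\<close> blocks, numbered from 0. Block \<open>i\<close> is
  the \<open>nrows i\<close> by \<open>ncols i\<close> matrix whose entry in row \<open>r\<close> and column \<open>c\<close> is the coordinate
  \<open>w $ coord i r c\<close>. Every coordinate is used exactly once, so that
  \<open>CARD('n) = (\<Sum>i<nblocks. nrows i * ncols i)\<close>.
\<close>

record 'n blocks =
  nblocks :: nat
  nrows :: "nat \<Rightarrow> nat"
  ncols :: "nat \<Rightarrow> nat"
  coord :: "nat \<Rightarrow> nat \<Rightarrow> nat \<Rightarrow> 'n"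

definition block_structure :: "'n::finite blocks \<Rightarrow> bool" where
  "block_structure B \<longleftrightarrow>
     bij_betw (\<lambda>(i, r, c). coord B i r c)
       (SIGMA i:{..<nblocks B}. {..<nrows B i} \<times> {..<ncols B i}) UNIV"

text \<open>
  The \<open>\<ell>\<^sup>2\<close> norm of a matrix is taken entrywise, in agreement with \<open>norm\<close> on \<open>real ^ 'n ^ 'm\<close>.
\<close>

definition block_norm :: "'n::finite blocks \<Rightarrow> real ^ 'n \<Rightarrow> nat \<Rightarrow> real" where
  "block_norm B w i =
     L2_set (\<lambda>(r, c). w $ coord B i r c) ({..<nrows B i} \<times> {..<ncols B i})"

definition poly_bounded ::
    "'n::finite blocks \<Rightarrow> (real ^ 'n) set \<Rightarrow> (real ^ 'n \<Rightarrow> 'a::real_normed_vector) \<Rightarrow> bool" where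
  "poly_bounded B \<Omega> \<psi> \<longleftrightarrow>
     (\<exists>S. pos_mpoly (nblocks B) S \<and>
       (\<forall>w\<in>\<Omega>. norm (\<psi> w) \<le> mpoly_eval S (block_norm B w)))"

definition poly_gen_continuous ::
    "'n::finite blocks \<Rightarrow> (real ^ 'n) set \<Rightarrow> (real ^ 'n \<Rightarrow> 'a::real_normed_vector) \<Rightarrow> bool" where
  "poly_gen_continuous B \<Omega> \<psi> \<longleftrightarrow>
     (\<exists>S. pos_mpoly (nblocks B) S \<and>
       (\<forall>w\<in>\<Omega>. \<forall>w'\<in>\<Omega>.
         norm (\<psi> w - \<psi> w') \<le>
           mpoly_eval S (\<lambda>i. max (block_norm B w i) (block_norm B w' i)) * norm (w - w')))"

abbreviation gradient :: "(real ^ 'n \<Rightarrow> real ^ 'm) \<Rightarrow> real ^ 'n \<Rightarrow> real ^ 'n ^ 'm::finite" where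
  "gradient \<psi> \<equiv> \<lambda>w. jacobian \<psi> (at w)"

text \<open>
  Differentiability is that of the ambient space at each point of \<open>\<Omega>\<close>. For open \<open>\<Omega>\<close> this is the
  usual notion of a \<open>C\<^sup>1\<close> map on \<open>\<Omega>\<close>; openness itself is not required.
\<close>

definition C1_on :: "(real ^ 'n::finite) set \<Rightarrow> (real ^ 'n \<Rightarrow> real ^ 'm::finite) \<Rightarrow> bool" where
  "C1_on \<Omega> \<psi> \<longleftrightarrow> (\<forall>w\<in>\<Omega>. \<psi> differentiable (at w)) \<and> continuous_on \<Omega> (gradient \<psi>)"

definition poly_gen_smooth ::
    "'n::finite blocks \<Rightarrow> (real ^ 'n) set \<Rightarrow> (real ^ 'n \<Rightarrow> real ^ 'm::finite) \<Rightarrow> bool" where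
  "poly_gen_smooth B \<Omega> \<psi> \<longleftrightarrow> C1_on \<Omega> \<psi> \<and> poly_gen_continuous B \<Omega> (gradient \<psi>)"

definition poly_regular ::
    "'n::finite blocks \<Rightarrow> (real ^ 'n) set \<Rightarrow> (real ^ 'n \<Rightarrow> real ^ 'm::finite) \<Rightarrow> bool" where
  "poly_regular B \<Omega> \<psi> \<longleftrightarrow>
     C1_on \<Omega> \<psi> \<and>
     poly_bounded B \<Omega> \<psi> \<and> poly_bounded B \<Omega> (gradient \<psi>) \<and>
     poly_gen_continuous B \<Omega> \<psi> \<and> poly_gen_smooth B \<Omega> \<psi>"

definition vectorize :: "'a ^ 'd ^ 'm \<Rightarrow> 'a ^ ('m::finite \<times> 'd::finite)" where
  "vectorize A = (\<chi> p. A $ fst p $ snd p)"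

definition poly_regular_matrix ::
    "'n::finite blocks \<Rightarrow> (real ^ 'n) set \<Rightarrow> (real ^ 'n \<Rightarrow> real ^ 'd::finite ^ 'm::finite) \<Rightarrow> bool" where
  "poly_regular_matrix B \<Omega> \<psi> \<longleftrightarrow>
     C1_on \<Omega> (\<lambda>w. vectorize (\<psi> w)) \<and>
     poly_bounded B \<Omega> \<psi> \<and> poly_bounded B \<Omega> (gradient (\<lambda>w. vectorize (\<psi> w))) \<and>
     poly_gen_continuous B \<Omega> \<psi> \<and> poly_gen_smooth B \<Omega> (\<lambda>w. vectorize (\<psi> w))"

end

theory Submission
  imports Defs
begin

text \<open>
  For nonnegative arguments, the positive polynomials in \<open>\<parallel>w\<^sub>1\<parallel>, \<dots>\<close> are cofinal with the functions
  \<open>C (1 + \<parallel>w\<parallel>)\<^sup>N\<close>, so the block structure can be forgotten: boundedness becomes polynomial growth in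
  \<open>\<parallel>w\<parallel>\<close>, and generalized continuity becomes a Lipschitz bound whose constant grows polynomially in
  \<open>\<parallel>w\<parallel> + \<parallel>w'\<parallel>\<close>. Both properties are stable under sums, bounded bilinear maps and composition. The
  gradients of a product and of a composition are obtained from the given maps and gradients by
  precisely these operations, by the product rule and the chain rule, and their continuity is implied
  by the Lipschitz bound.
\<close>

section \<open>Evaluation of positive polynomials\<close>

text \<open>The additional monomials have coefficient 0. This lets \<open>S\<close>,
  \<open>T\<close> and \<open>S + T\<close> be summed over one common index set.\<close>

lemma mpoly_eval_superset:
  assumes "finite K" "Poly_Mapping.keys S \<subseteq> K"
  shows "mpoly_eval S x = (\<Sum>m\<in>K. Poly_Mapping.lookup S m *
    (\<Prod>i\<in>Poly_Mapping.keys m. x i ^ Poly_Mapping.lookup m i))"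
  unfolding mpoly_eval_def
  by (rule sum.mono_neutral_left) (use assms in \<open>auto simp: in_keys_iff\<close>)

lemma mpoly_eval_add: "mpoly_eval (S + T) x = mpoly_eval S x + mpoly_eval T x"
proof -
  let ?K = "Poly_Mapping.keys S \<union> Poly_Mapping.keys T"
  have "mpoly_eval (S + T) x = (\<Sum>m\<in>?K. Poly_Mapping.lookup (S + T) m *
    (\<Prod>i\<in>Poly_Mapping.keys m. x i ^ Poly_Mapping.lookup m i))"
    by (rule mpoly_eval_superset) (auto dest: subsetD[OF Poly_Mapping.keys_add])
  then show ?thesis
    by (simp add: mpoly_eval_superset[of ?K S] mpoly_eval_superset[of ?K T]
        lookup_add distrib_right sum.distrib)
qed

lemma mpoly_eval_single:
  "mpoly_eval (Poly_Mapping.single m c) x =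
    c * (\<Prod>i\<in>Poly_Mapping.keys m. x i ^ Poly_Mapping.lookup m i)"
  by (simp add: mpoly_eval_def)

lemma pos_mpoly_lookup_nonneg: "pos_mpoly k S \<Longrightarrow> 0 \<le> Poly_Mapping.lookup S m"
  by (cases "m \<in> Poly_Mapping.keys S") (simp_all add: pos_mpoly_def in_keys_iff less_imp_le)

text \<open>Nonnegative coefficients cannot cancel: a coefficient of the sum that is nonzero is
  already positive, and its monomial occurs in one of the summands.\<close>

lemma pos_mpoly_add:
  assumes S: "pos_mpoly k S" and T: "pos_mpoly k T"
  shows "pos_mpoly k (S + T)"
  unfolding pos_mpoly_def
proof (intro ballI conjI)
  fix m assume m: "m \<in> Poly_Mapping.keys (S + T)"
  then have "Poly_Mapping.lookup S m + Poly_Mapping.lookup T m \<noteq> 0"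
    by (simp add: in_keys_iff lookup_add)
  then show "0 < Poly_Mapping.lookup (S + T) m"
    using pos_mpoly_lookup_nonneg[OF S, of m] pos_mpoly_lookup_nonneg[OF T, of m]
    unfolding lookup_add by linarith
  from m have "m \<in> Poly_Mapping.keys S \<or> m \<in> Poly_Mapping.keys T"
    using Poly_Mapping.keys_add[of S T] by auto
  then show "Poly_Mapping.keys m \<subseteq> {..<k}"
    using S T unfolding pos_mpoly_def by auto
qed

lemma pos_mpoly_single:
  "c > 0 \<Longrightarrow> Poly_Mapping.keys m \<subseteq> {..<k} \<Longrightarrow> pos_mpoly k (Poly_Mapping.single m c)"
  by (simp add: pos_mpoly_def)

text \<open>Supplies the explicit positive polynomial that later dominates powers of
  \<open>1 + M\<close>.\<close>

lemma pos_mpoly_power_sum: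
  assumes "c > 0"
  shows "\<exists>S. pos_mpoly k S \<and> (\<forall>x. mpoly_eval S x = c * (1 + (\<Sum>i<k. x i ^ N)))"
proof -
  \<comment> \<open>The induction adds one variable at a time; \<open>k\<close> stays fixed, so that
    all intermediate polynomials are positive over the same set of variables.\<close>
  have "\<exists>S. pos_mpoly k S \<and> (\<forall>x. mpoly_eval S x = c * (1 + (\<Sum>i<j. x i ^ N)))" if "j \<le> k" for j
    using that
  proof (induction j)
    case 0
    show ?case
      by (rule exI[of _ "Poly_Mapping.single 0 c"])
        (simp add: pos_mpoly_single assms mpoly_eval_single)
  next
    case (Suc j)
    then obtain S where S: "pos_mpoly k S"
      "\<And>x. mpoly_eval S x = c * (1 + (\<Sum>i<j. x i ^ N))" by auto
    let ?T = "Poly_Mapping.single (Poly_Mapping.single j N) c"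
    have "pos_mpoly k (S + ?T)"
      using S(1) Suc.prems assms by (intro pos_mpoly_add pos_mpoly_single) auto
    moreover have "mpoly_eval (S + ?T) x = c * (1 + (\<Sum>i<Suc j. x i ^ N))" for x
      \<comment> \<open>For \<open>N = 0\<close> the monomial \<open>Poly_Mapping.single j N\<close>
        is the empty one, whose value 1 agrees with \<open>x j ^ 0\<close>.\<close>
      by (cases "N = 0") (simp_all add: mpoly_eval_add mpoly_eval_single S(2) algebra_simps)
    ultimately show ?case by blast
  qed
  then show ?thesis by blast
qed

text \<open>Each variable is at most \<open>1 + M\<close>, so a monomial is at most
  \<open>1 + M\<close> to its degree. Since \<open>1 + M \<ge> 1\<close>, all these exponents can be
  raised to a common one, and \<open>C\<close> collects the coefficients.\<close>

lemma mpoly_eval_le_power: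
  assumes "pos_mpoly k S"
  shows "\<exists>C\<ge>0. \<exists>N. \<forall>x M. (\<forall>i<k. 0 \<le> x i \<and> x i \<le> M) \<longrightarrow> 0 \<le> M \<longrightarrow> mpoly_eval S x \<le> C * (1 + M) ^ N"
proof -
  define deg :: "(nat \<Rightarrow>\<^sub>0 nat) \<Rightarrow> nat"
    where "deg m = (\<Sum>i\<in>Poly_Mapping.keys m. Poly_Mapping.lookup m i)" for m
  \<comment> \<open>The sum of the degrees is a convenient upper bound of each of them; it makes
    sense also for the zero polynomial.\<close>
  define N where "N = (\<Sum>m\<in>Poly_Mapping.keys S. deg m)"
  define C where "C = (\<Sum>m\<in>Poly_Mapping.keys S. Poly_Mapping.lookup S m)"
  have "C \<ge> 0"
    unfolding C_def using assms by (intro sum_nonneg) (auto simp: pos_mpoly_def less_imp_le)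
  moreover have "mpoly_eval S x \<le> C * (1 + M) ^ N"
    if x: "\<forall>i<k. 0 \<le> x i \<and> x i \<le> M" and "0 \<le> M" for x M
    unfolding mpoly_eval_def C_def sum_distrib_right
  proof (rule sum_mono)
    fix m assume m: "m \<in> Poly_Mapping.keys S"
    then have pos: "Poly_Mapping.lookup S m > 0" and sub: "Poly_Mapping.keys m \<subseteq> {..<k}"
      using assms by (auto simp: pos_mpoly_def)
    have "(\<Prod>i\<in>Poly_Mapping.keys m. x i ^ Poly_Mapping.lookup m i)
        \<le> (\<Prod>i\<in>Poly_Mapping.keys m. (1 + M) ^ Poly_Mapping.lookup m i)"
    proof (rule prod_mono)
      fix i assume "i \<in> Poly_Mapping.keys m"
      then have "0 \<le> x i" "x i \<le> 1 + M" using sub x by force+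
      then show "0 \<le> x i ^ Poly_Mapping.lookup m i \<and>
          x i ^ Poly_Mapping.lookup m i \<le> (1 + M) ^ Poly_Mapping.lookup m i"
        by (simp add: power_mono)
    qed
    also have "\<dots> = (1 + M) ^ deg m" by (simp add: deg_def power_sum)
    also have "\<dots> \<le> (1 + M) ^ N"
      using \<open>0 \<le> M\<close> m unfolding N_def by (intro power_increasing member_le_sum) auto
    finally show "Poly_Mapping.lookup S m *
        (\<Prod>i\<in>Poly_Mapping.keys m. x i ^ Poly_Mapping.lookup m i)
        \<le> Poly_Mapping.lookup S m * (1 + M) ^ N"
      using pos by (simp add: mult_left_mono)
  qed
  ultimately show ?thesis by blast
qed

text \<open>
  The factor 2 allows \<open>M = \<parallel>w\<parallel> + \<parallel>w'\<parallel>\<close> when \<open>x i\<close> is the maximum of the two block norms.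
\<close>

lemma power_le_mpoly_eval:
  assumes "C \<ge> 0"
  shows "\<exists>S. pos_mpoly k S \<and> (\<forall>x M. (\<forall>i<k. 0 \<le> x i) \<longrightarrow> 0 \<le> M \<longrightarrow> M \<le> 2 * (\<Sum>i<k. x i) \<longrightarrow>
    C * (1 + M) ^ N \<le> mpoly_eval S x)"
proof -
  \<comment> \<open>\<open>D\<close> comes from \<open>1 + M \<le> (1 + 2 * real k) * m\<close>,
    where \<open>m\<close> is the largest of 1 and the \<open>x i\<close>.\<close>
  define D where "D = (1 + 2 * real k) ^ N"
  have D: "D > 0" by (simp add: D_def)
  obtain S where S: "pos_mpoly k S"
    \<comment> \<open>The extra 1 keeps the coefficient positive when \<open>C = 0\<close>.\<close>
    "\<And>x. mpoly_eval S x = (C * D + 1) * (1 + (\<Sum>i<k. x i ^ N))"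
    using pos_mpoly_power_sum[of "C * D + 1" k N] assms D by (auto simp: add_nonneg_pos)
  have "C * (1 + M) ^ N \<le> mpoly_eval S x"
    if x: "\<forall>i<k. 0 \<le> x i" and M: "0 \<le> M" "M \<le> 2 * (\<Sum>i<k. x i)" for x M
  proof -
    \<comment> \<open>Inserting 1 gives \<open>m \<ge> 1\<close>, and keeps the set nonempty when
      \<open>k = 0\<close>.\<close>
    define m where "m = Max (insert 1 (x ` {..<k}))"
    have m1: "1 \<le> m" and mx: "\<And>i. i < k \<Longrightarrow> x i \<le> m" unfolding m_def by auto
    have "(\<Sum>i<k. x i) \<le> real k * m" using sum_bounded_above[of "{..<k}" x m] mx by simp
    then have "1 + M \<le> (1 + 2 * real k) * m" using M m1 by (simp add: algebra_simps)
    then have "(1 + M) ^ N \<le> ((1 + 2 * real k) * m) ^ N" using M by (intro power_mono) auto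
    then have "(1 + M) ^ N \<le> D * m ^ N" by (simp add: D_def power_mult_distrib)
    moreover have nn: "0 \<le> (\<Sum>i<k. x i ^ N)" using x by (intro sum_nonneg) auto
    \<comment> \<open>The maximum is attained: either it is 1, or it is some \<open>x j\<close>,
      whose power is one of the summands.\<close>
    have "m ^ N \<le> 1 + (\<Sum>i<k. x i ^ N)"
    proof (cases "m = 1")
      case True then show ?thesis using nn by simp
    next
      case False
      have "m \<in> insert 1 (x ` {..<k})" unfolding m_def by (rule Max_in) auto
      then obtain j where "j < k" "m = x j" using False by auto
      then have "m ^ N \<le> (\<Sum>i<k. x i ^ N)"
        using x member_le_sum[of j "{..<k}" "\<lambda>i. x i ^ N"] by auto
      then show ?thesis by simp
    qed
    ultimately have "(1 + M) ^ N \<le> D * (1 + (\<Sum>i<k. x i ^ N))"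
      using D by (meson mult_left_mono less_imp_le order_trans)
    then have "C * (1 + M) ^ N \<le> C * D * (1 + (\<Sum>i<k. x i ^ N))"
      using assms by (simp add: mult_left_mono mult.assoc)
    also have "\<dots> \<le> mpoly_eval S x" unfolding S(2) using nn by (intro mult_right_mono) auto
    finally show ?thesis .
  qed
  then show ?thesis using S(1) by blast
qed

section \<open>Block norms\<close>

lemma block_norm_nonneg: "0 \<le> block_norm B w i"
  by (simp add: block_norm_def L2_set_nonneg)

text \<open>The bijection between positions (block, row, column) and coordinates regroups the sum of
  squares block by block.\<close>

lemma norm_square_eq_blocks:
  assumes "block_structure B"
  shows "(norm w)\<^sup>2 = (\<Sum>i<nblocks B. (block_norm B w i)\<^sup>2)"
proof -
  let ?I = "SIGMA i:{..<nblocks B}. {..<nrows B i} \<times> {..<ncols B i}"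
  have "(norm w)\<^sup>2 = (\<Sum>j\<in>UNIV. (w $ j)\<^sup>2)"
    by (simp add: norm_vec_def L2_set_def sum_nonneg)
  also have "\<dots> = (\<Sum>p\<in>?I. (w $ (\<lambda>(i, r, c). coord B i r c) p)\<^sup>2)"
    using assms unfolding block_structure_def by (rule sum.reindex_bij_betw[symmetric])
  also have "\<dots> = (\<Sum>i<nblocks B. \<Sum>q\<in>{..<nrows B i} \<times> {..<ncols B i}.
      (w $ (\<lambda>(i, r, c). coord B i r c) (i, q))\<^sup>2)"
    by (subst sum.Sigma) (auto intro: sum.cong)
  also have "\<dots> = (\<Sum>i<nblocks B. (block_norm B w i)\<^sup>2)"
    by (simp add: block_norm_def L2_set_def sum_nonneg case_prod_unfold)
  finally show ?thesis .
qed

lemma block_norm_le_norm: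
  assumes "block_structure B" "i < nblocks B"
  shows "block_norm B w i \<le> norm w"
proof (rule power2_le_imp_le)
  show "(block_norm B w i)\<^sup>2 \<le> (norm w)\<^sup>2"
    unfolding norm_square_eq_blocks[OF assms(1)] using assms(2) by (intro member_le_sum) auto
qed simp

lemma norm_le_sum_block_norm:
  assumes "block_structure B"
  shows "norm w \<le> (\<Sum>i<nblocks B. block_norm B w i)"
proof -
  have "norm w = L2_set (block_norm B w) {..<nblocks B}"
    unfolding L2_set_def norm_square_eq_blocks[OF assms, symmetric] by simp
  then show ?thesis by (simp add: L2_set_le_sum block_norm_nonneg)
qed

section \<open>Functions of polynomial growth\<close>

text \<open>The index set and the size \<open>p\<close> are left abstract so that one calculus
  serves points, with \<open>p = norm\<close>, and pairs of points, with the sum of their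
  norms.\<close>

definition poly_major :: "'s set \<Rightarrow> ('s \<Rightarrow> real) \<Rightarrow> ('s \<Rightarrow> real) \<Rightarrow> bool" where
  "poly_major A p g \<longleftrightarrow> (\<exists>C\<ge>0. \<exists>N. \<forall>s\<in>A. \<bar>g s\<bar> \<le> C * (1 + p s) ^ N)"

lemma poly_majorI:
  "C \<ge> 0 \<Longrightarrow> (\<And>s. s \<in> A \<Longrightarrow> \<bar>g s\<bar> \<le> C * (1 + p s) ^ N) \<Longrightarrow> poly_major A p g"
  unfolding poly_major_def by blast

lemma poly_major_le:
  assumes "poly_major A p h" "\<And>s. s \<in> A \<Longrightarrow> \<bar>g s\<bar> \<le> \<bar>h s\<bar>"
  shows "poly_major A p g"
  using assms unfolding poly_major_def by (meson order_trans)

lemma poly_major_subset: "poly_major A p g \<Longrightarrow> A' \<subseteq> A \<Longrightarrow> poly_major A' p g"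
  unfolding poly_major_def by blast

lemma poly_major_const: "poly_major A p (\<lambda>s. c)"
  by (rule poly_majorI[of "\<bar>c\<bar>" _ _ _ 0]) auto

lemma poly_major_self: "(\<And>s. s \<in> A \<Longrightarrow> 0 \<le> p s) \<Longrightarrow> poly_major A p p"
  by (rule poly_majorI[of 1 _ _ _ 1]) auto

lemma poly_major_mult:
  assumes "poly_major A p g" "poly_major A p h"
  shows "poly_major A p (\<lambda>s. g s * h s)"
proof -
  obtain C N D M where "C \<ge> 0" "D \<ge> 0"
    and g: "\<And>s. s \<in> A \<Longrightarrow> \<bar>g s\<bar> \<le> C * (1 + p s) ^ N"
    and h: "\<And>s. s \<in> A \<Longrightarrow> \<bar>h s\<bar> \<le> D * (1 + p s) ^ M"
    using assms unfolding poly_major_def by blast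
  show ?thesis
  proof (rule poly_majorI[of "C * D" _ _ _ "N + M"])
    fix s assume s: "s \<in> A"
    have "\<bar>g s * h s\<bar> \<le> (C * (1 + p s) ^ N) * (D * (1 + p s) ^ M)"
      unfolding abs_mult using g[OF s] h[OF s] by (intro mult_mono) auto
    then show "\<bar>g s * h s\<bar> \<le> C * D * (1 + p s) ^ (N + M)"
      by (simp add: power_add algebra_simps)
  qed (use \<open>C \<ge> 0\<close> \<open>D \<ge> 0\<close> in simp)
qed

lemma poly_major_add:
  assumes p: "\<And>s. s \<in> A \<Longrightarrow> 0 \<le> p s" and "poly_major A p g" "poly_major A p h"
  shows "poly_major A p (\<lambda>s. g s + h s)"
proof -
  obtain C N D M where "C \<ge> 0" "D \<ge> 0"
    and g: "\<And>s. s \<in> A \<Longrightarrow> \<bar>g s\<bar> \<le> C * (1 + p s) ^ N"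
    and h: "\<And>s. s \<in> A \<Longrightarrow> \<bar>h s\<bar> \<le> D * (1 + p s) ^ M"
    using assms(2,3) unfolding poly_major_def by blast
  show ?thesis
  proof (rule poly_majorI[of "C + D" _ _ _ "N + M"])
    fix s assume s: "s \<in> A"
    \<comment> \<open>Both bounds are brought to the common exponent \<open>N + M\<close>, using
      \<open>1 + p s \<ge> 1\<close>.\<close>
    have "C * (1 + p s) ^ N \<le> C * (1 + p s) ^ (N + M)" "D * (1 + p s) ^ M \<le> D * (1 + p s) ^ (N + M)"
      using p[OF s] \<open>C \<ge> 0\<close> \<open>D \<ge> 0\<close> by (intro mult_left_mono power_increasing; simp)+
    then show "\<bar>g s + h s\<bar> \<le> (C + D) * (1 + p s) ^ (N + M)"
      using g[OF s] h[OF s] by (simp add: algebra_simps)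
  qed (use \<open>C \<ge> 0\<close> \<open>D \<ge> 0\<close> in simp)
qed

lemma poly_major_power: "poly_major A p g \<Longrightarrow> poly_major A p (\<lambda>s. g s ^ N)"
  by (induction N) (auto intro: poly_major_const poly_major_mult)

text \<open>Substituting \<open>\<phi> s\<close> into the bound for \<open>g\<close> gives a
  polynomial expression in \<open>q (\<phi> s)\<close>, which is majorized by closure under sums,
  products and powers.\<close>

lemma poly_major_compose:
  assumes p: "\<And>s. s \<in> A \<Longrightarrow> 0 \<le> p s" and q: "\<And>t. t \<in> A' \<Longrightarrow> 0 \<le> q t"
    and g: "poly_major A' q g" and \<phi>: "\<And>s. s \<in> A \<Longrightarrow> \<phi> s \<in> A'"
    and h: "poly_major A p (\<lambda>s. q (\<phi> s))"
  shows "poly_major A p (\<lambda>s. g (\<phi> s))"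
proof -
  obtain C N where "C \<ge> 0" and C: "\<And>t. t \<in> A' \<Longrightarrow> \<bar>g t\<bar> \<le> C * (1 + q t) ^ N"
    using g unfolding poly_major_def by blast
  have "poly_major A p (\<lambda>s. C * (1 + q (\<phi> s)) ^ N)"
    by (intro poly_major_mult poly_major_power poly_major_add poly_major_const h p)
  then show ?thesis
    by (rule poly_major_le) (use C \<phi> in fastforce)
qed

section \<open>Maps of polynomial growth and maps with polynomially growing Lipschitz
  constants\<close>

definition poly_growth :: "'a::real_normed_vector set \<Rightarrow> ('a \<Rightarrow> 'b::real_normed_vector) \<Rightarrow> bool" where
  "poly_growth \<Omega> f \<longleftrightarrow> poly_major \<Omega> norm (\<lambda>w. norm (f w))"

text \<open>\<open>L\<close> may be any majorized function of the pair, so that Lipschitz constants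
  are combined with the closure rules of \<open>poly_major\<close> instead of explicit
  exponents.\<close>

definition poly_lipschitz :: "'a::real_normed_vector set \<Rightarrow> ('a \<Rightarrow> 'b::real_normed_vector) \<Rightarrow> bool" where
  "poly_lipschitz \<Omega> f \<longleftrightarrow>
     (\<exists>L. poly_major (\<Omega> \<times> \<Omega>) (\<lambda>(w, w'). norm w + norm w') L \<and>
       (\<forall>w\<in>\<Omega>. \<forall>w'\<in>\<Omega>. norm (f w - f w') \<le> L (w, w') * norm (w - w')))"

lemma poly_lipschitzI:
  assumes "poly_major (\<Omega> \<times> \<Omega>) (\<lambda>(w, w'). norm w + norm w') L"
    "\<And>w w'. w \<in> \<Omega> \<Longrightarrow> w' \<in> \<Omega> \<Longrightarrow> norm (f w - f w') \<le> L (w, w') * norm (w - w')"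
  shows "poly_lipschitz \<Omega> f"
  using assms unfolding poly_lipschitz_def by blast

text \<open>Passing to \<open>\<bar>L s\<bar>\<close> makes the constant nonnegative, which
  composition needs in order to multiply an estimate by it.\<close>

lemma poly_lipschitzE:
  assumes "poly_lipschitz \<Omega> f"
  obtains L where "poly_major (\<Omega> \<times> \<Omega>) (\<lambda>(w, w'). norm w + norm w') L"
    "\<And>w w'. w \<in> \<Omega> \<Longrightarrow> w' \<in> \<Omega> \<Longrightarrow> norm (f w - f w') \<le> L (w, w') * norm (w - w')"
    "\<And>s. 0 \<le> L s"
proof -
  obtain L where L: "poly_major (\<Omega> \<times> \<Omega>) (\<lambda>(w, w'). norm w + norm w') L"
    "\<And>w w'. w \<in> \<Omega> \<Longrightarrow> w' \<in> \<Omega> \<Longrightarrow> norm (f w - f w') \<le> L (w, w') * norm (w - w')"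
    using assms unfolding poly_lipschitz_def by blast
  show ?thesis
  proof (rule that[of "\<lambda>s. \<bar>L s\<bar>"])
    show "poly_major (\<Omega> \<times> \<Omega>) (\<lambda>(w, w'). norm w + norm w') (\<lambda>s. \<bar>L s\<bar>)"
      by (rule poly_major_le[OF L(1)]) simp
    show "norm (f w - f w') \<le> \<bar>L (w, w')\<bar> * norm (w - w')" if "w \<in> \<Omega>" "w' \<in> \<Omega>" for w w'
      using L(2)[OF that] by (meson abs_ge_self mult_right_mono norm_ge_zero order_trans)
  qed simp
qed

lemma poly_growth_subset: "poly_growth \<Omega> f \<Longrightarrow> \<Omega>' \<subseteq> \<Omega> \<Longrightarrow> poly_growth \<Omega>' f"
  unfolding poly_growth_def by (rule poly_major_subset)

lemma poly_lipschitz_subset: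
  assumes "poly_lipschitz \<Omega> f" "\<Omega>' \<subseteq> \<Omega>"
  shows "poly_lipschitz \<Omega>' f"
proof -
  from assms(1) obtain L where L: "poly_major (\<Omega> \<times> \<Omega>) (\<lambda>(w, w'). norm w + norm w') L"
    "\<And>w w'. w \<in> \<Omega> \<Longrightarrow> w' \<in> \<Omega> \<Longrightarrow> norm (f w - f w') \<le> L (w, w') * norm (w - w')"
    by (rule poly_lipschitzE) blast
  show ?thesis
    by (rule poly_lipschitzI[OF poly_major_subset[OF L(1)] L(2)]) (use assms(2) in blast)+
qed

lemma poly_growth_cong: "poly_growth \<Omega> f \<Longrightarrow> (\<And>w. w \<in> \<Omega> \<Longrightarrow> f w = g w) \<Longrightarrow> poly_growth \<Omega> g"
  unfolding poly_growth_def by (erule poly_major_le) simp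

lemma poly_lipschitz_cong: "poly_lipschitz \<Omega> f \<Longrightarrow> (\<And>w. w \<in> \<Omega> \<Longrightarrow> f w = g w) \<Longrightarrow> poly_lipschitz \<Omega> g"
  unfolding poly_lipschitz_def by auto

lemma poly_growth_add:
  assumes "poly_growth \<Omega> f" "poly_growth \<Omega> g"
  shows "poly_growth \<Omega> (\<lambda>w. f w + g w)"
proof -
  have "poly_major \<Omega> norm (\<lambda>w. norm (f w) + norm (g w))"
    using assms unfolding poly_growth_def by (intro poly_major_add) auto
  then show ?thesis
    unfolding poly_growth_def by (rule poly_major_le) (simp add: norm_triangle_ineq)
qed

lemma poly_lipschitz_add:
  assumes "poly_lipschitz \<Omega> f" "poly_lipschitz \<Omega> g"
  shows "poly_lipschitz \<Omega> (\<lambda>w. f w + g w)"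
proof -
  from assms(1) obtain L where L: "poly_major (\<Omega> \<times> \<Omega>) (\<lambda>(w, w'). norm w + norm w') L"
    "\<And>w w'. w \<in> \<Omega> \<Longrightarrow> w' \<in> \<Omega> \<Longrightarrow> norm (f w - f w') \<le> L (w, w') * norm (w - w')"
    by (rule poly_lipschitzE) blast
  from assms(2) obtain M where M: "poly_major (\<Omega> \<times> \<Omega>) (\<lambda>(w, w'). norm w + norm w') M"
    "\<And>w w'. w \<in> \<Omega> \<Longrightarrow> w' \<in> \<Omega> \<Longrightarrow> norm (g w - g w') \<le> M (w, w') * norm (w - w')"
    by (rule poly_lipschitzE) blast
  show ?thesis
  proof (rule poly_lipschitzI)
    show "poly_major (\<Omega> \<times> \<Omega>) (\<lambda>(w, w'). norm w + norm w') (\<lambda>s. L s + M s)"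
      by (rule poly_major_add[OF _ L(1) M(1)]) auto
    fix w w' assume w: "w \<in> \<Omega>" "w' \<in> \<Omega>"
    have "norm (f w + g w - (f w' + g w')) \<le> norm (f w - f w') + norm (g w - g w')"
      by (rule norm_diff_triangle_ineq)
    then show "norm (f w + g w - (f w' + g w')) \<le> (L (w, w') + M (w, w')) * norm (w - w')"
      using L(2)[OF w] M(2)[OF w] by (simp add: algebra_simps)
  qed
qed

text \<open>Since \<open>norm w \<le> norm w + norm w'\<close>, growth at one point can enter a
  Lipschitz constant for a pair.\<close>

lemma poly_growth_fst:
  assumes "poly_growth \<Omega> f"
  shows "poly_major (\<Omega> \<times> \<Omega>) (\<lambda>(w, w'). norm w + norm w') (\<lambda>s. norm (f (fst s)))"
proof (rule poly_major_compose[where A' = \<Omega> and q = norm and g = "\<lambda>w. norm (f w)" and \<phi> = fst])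
  show "poly_major (\<Omega> \<times> \<Omega>) (\<lambda>(w, w'). norm w + norm w') (\<lambda>s. norm (fst s))"
    by (rule poly_major_le[OF poly_major_self]) auto
qed (use assms in \<open>auto simp: poly_growth_def\<close>)

lemma poly_growth_snd:
  assumes "poly_growth \<Omega> f"
  shows "poly_major (\<Omega> \<times> \<Omega>) (\<lambda>(w, w'). norm w + norm w') (\<lambda>s. norm (f (snd s)))"
proof (rule poly_major_compose[where A' = \<Omega> and q = norm and g = "\<lambda>w. norm (f w)" and \<phi> = snd])
  show "poly_major (\<Omega> \<times> \<Omega>) (\<lambda>(w, w'). norm w + norm w') (\<lambda>s. norm (snd s))"
    by (rule poly_major_le[OF poly_major_self]) auto
qed (use assms in \<open>auto simp: poly_growth_def\<close>)

lemma poly_growth_bilinear: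
  assumes "bounded_bilinear b" "poly_growth \<Omega> f" "poly_growth \<Omega> g"
  shows "poly_growth \<Omega> (\<lambda>w. b (f w) (g w))"
proof -
  obtain K where K: "K > 0" "\<And>u v. norm (b u v) \<le> norm u * norm v * K"
    using bounded_bilinear.pos_bounded[OF assms(1)] by blast
  have "poly_major \<Omega> norm (\<lambda>w. norm (f w) * norm (g w) * K)"
    using assms(2,3) unfolding poly_growth_def by (intro poly_major_mult poly_major_const)
  then show ?thesis unfolding poly_growth_def
    by (rule poly_major_le) (use K in \<open>simp add: abs_mult\<close>)
qed

text \<open>The increment is split into two terms that each change one factor only. The Lipschitz
  bounds control the changing factor, the growth bounds the other.\<close>

lemma poly_lipschitz_bilinear:
  assumes b: "bounded_bilinear b" and bounds: "poly_growth \<Omega> f" "poly_growth \<Omega> g"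
    and lips: "poly_lipschitz \<Omega> f" "poly_lipschitz \<Omega> g"
  shows "poly_lipschitz \<Omega> (\<lambda>w. b (f w) (g w))"
proof -
  interpret bounded_bilinear b by (rule b)
  obtain K where K: "K > 0" "\<And>u v. norm (b u v) \<le> norm u * norm v * K"
    using pos_bounded by blast
  from lips(1) obtain L where L: "poly_major (\<Omega> \<times> \<Omega>) (\<lambda>(w, w'). norm w + norm w') L"
    "\<And>w w'. w \<in> \<Omega> \<Longrightarrow> w' \<in> \<Omega> \<Longrightarrow> norm (f w - f w') \<le> L (w, w') * norm (w - w')"
    by (rule poly_lipschitzE) blast
  from lips(2) obtain M where M: "poly_major (\<Omega> \<times> \<Omega>) (\<lambda>(w, w'). norm w + norm w') M"
    "\<And>w w'. w \<in> \<Omega> \<Longrightarrow> w' \<in> \<Omega> \<Longrightarrow> norm (g w - g w') \<le> M (w, w') * norm (w - w')"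
    by (rule poly_lipschitzE) blast
  \<comment> \<open>The split first changes \<open>f\<close> with \<open>g\<close> held at
    \<open>w\<close>, then \<open>g\<close> with \<open>f\<close> held at \<open>w'\<close>; hence
    \<open>fst\<close> for \<open>g\<close> and \<open>snd\<close> for \<open>f\<close>.\<close>
  let ?L = "\<lambda>s. (L s * norm (g (fst s)) + norm (f (snd s)) * M s) * K"
  show ?thesis
  proof (rule poly_lipschitzI)
    show "poly_major (\<Omega> \<times> \<Omega>) (\<lambda>(w, w'). norm w + norm w') ?L"
      by (intro poly_major_mult poly_major_add poly_major_const poly_growth_fst poly_growth_snd
          bounds L M) auto
    fix w w' assume w: "w \<in> \<Omega>" "w' \<in> \<Omega>"
    have "b (f w) (g w) - b (f w') (g w') = b (f w - f w') (g w) + b (f w') (g w - g w')"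
      by (simp add: diff_left diff_right)
    then have "norm (b (f w) (g w) - b (f w') (g w'))
        \<le> norm (f w - f w') * norm (g w) * K + norm (f w') * norm (g w - g w') * K"
      using K(2) by (metis add_mono norm_triangle_le)
    also have "\<dots> \<le> (L (w, w') * norm (w - w')) * norm (g w) * K +
        norm (f w') * (M (w, w') * norm (w - w')) * K"
      using L(2)[OF w] M(2)[OF w] K(1)
      by (intro add_mono mult_right_mono mult_left_mono) auto
    finally show "norm (b (f w) (g w) - b (f w') (g w')) \<le> ?L (w, w') * norm (w - w')"
      by (simp add: algebra_simps)
  qed
qed

lemma poly_growth_compose:
  assumes "poly_growth \<Omega> f" "poly_growth \<Omega>' g" "g ` \<Omega>' \<subseteq> \<Omega>"
  shows "poly_growth \<Omega>' (\<lambda>w. f (g w))"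
  unfolding poly_growth_def
  by (rule poly_major_compose[where A' = \<Omega> and q = norm and g = "\<lambda>w. norm (f w)" and \<phi> = g])
    (use assms in \<open>auto simp: poly_growth_def\<close>)

text \<open>The Lipschitz constants multiply, but that of \<open>f\<close> is taken at image points;
  the growth of \<open>g\<close> bounds it polynomially in the original points.\<close>

lemma poly_lipschitz_compose:
  assumes f: "poly_lipschitz \<Omega> f" and g: "poly_lipschitz \<Omega>' g" "poly_growth \<Omega>' g"
    and sub: "g ` \<Omega>' \<subseteq> \<Omega>"
  shows "poly_lipschitz \<Omega>' (\<lambda>w. f (g w))"
proof -
  from f obtain L where L: "poly_major (\<Omega> \<times> \<Omega>) (\<lambda>(w, w'). norm w + norm w') L"
    "\<And>w w'. w \<in> \<Omega> \<Longrightarrow> w' \<in> \<Omega> \<Longrightarrow> norm (f w - f w') \<le> L (w, w') * norm (w - w')" "\<And>s. 0 \<le> L s"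
    by (rule poly_lipschitzE) blast
  from g(1) obtain M where M: "poly_major (\<Omega>' \<times> \<Omega>') (\<lambda>(w, w'). norm w + norm w') M"
    "\<And>w w'. w \<in> \<Omega>' \<Longrightarrow> w' \<in> \<Omega>' \<Longrightarrow> norm (g w - g w') \<le> M (w, w') * norm (w - w')"
    by (rule poly_lipschitzE) blast
  have "poly_major (\<Omega>' \<times> \<Omega>') (\<lambda>(w, w'). norm w + norm w') (\<lambda>s. norm (g (fst s)) + norm (g (snd s)))"
    by (rule poly_major_add[OF _ poly_growth_fst[OF g(2)] poly_growth_snd[OF g(2)]]) auto
  then have "poly_major (\<Omega>' \<times> \<Omega>') (\<lambda>(w, w'). norm w + norm w') (\<lambda>s. L (map_prod g g s))"
    using sub by (intro poly_major_compose[OF _ _ L(1)]) (auto simp: case_prod_unfold image_subset_iff)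
  then have "poly_major (\<Omega>' \<times> \<Omega>') (\<lambda>(w, w'). norm w + norm w') (\<lambda>s. L (map_prod g g s) * M s)"
    using M(1) by (rule poly_major_mult)
  then show ?thesis
  proof (rule poly_lipschitzI)
    fix w w' assume w: "w \<in> \<Omega>'" "w' \<in> \<Omega>'"
    have "norm (f (g w) - f (g w')) \<le> L (g w, g w') * norm (g w - g w')"
      using w sub by (intro L(2)) auto
    also have "\<dots> \<le> L (g w, g w') * (M (w, w') * norm (w - w'))"
      by (intro mult_left_mono M(2) w L(3))
    finally show "norm (f (g w) - f (g w')) \<le> L (map_prod g g (w, w')) * M (w, w') * norm (w - w')"
      by simp
  qed
qed

text \<open>Near a fixed point \<open>a\<close> the polynomial constant has a finite limit, so its
  product with \<open>norm (w - a)\<close> tends to 0.\<close>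

lemma poly_lipschitz_continuous_on:
  assumes "poly_lipschitz \<Omega> f"
  shows "continuous_on \<Omega> f"
  unfolding continuous_on_def
proof
  fix a assume a: "a \<in> \<Omega>"
  obtain L where L: "poly_major (\<Omega> \<times> \<Omega>) (\<lambda>(w, w'). norm w + norm w') L"
    "\<And>w w'. w \<in> \<Omega> \<Longrightarrow> w' \<in> \<Omega> \<Longrightarrow> norm (f w - f w') \<le> L (w, w') * norm (w - w')"
    using assms by (rule poly_lipschitzE) blast
  obtain C N where C: "\<And>s. s \<in> \<Omega> \<times> \<Omega> \<Longrightarrow> \<bar>L s\<bar> \<le> C * (1 + (case s of (w, w') \<Rightarrow> norm w + norm w')) ^ N"
    using L(1) unfolding poly_major_def by blast
  have bound: "norm (f w - f a) \<le> C * (1 + (norm w + norm a)) ^ N * norm (w - a)" if "w \<in> \<Omega>" for w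
  proof -
    have "L (w, a) \<le> C * (1 + (norm w + norm a)) ^ N" using C[of "(w, a)"] that a by auto
    then show ?thesis
      using L(2)[OF that a] by (meson mult_right_mono norm_ge_zero order_trans)
  qed
  have "((\<lambda>w. C * (1 + (norm w + norm a)) ^ N * norm (w - a)) \<longlongrightarrow>
      C * (1 + (norm a + norm a)) ^ N * norm (a - a)) (at a within \<Omega>)"
    by (intro tendsto_intros)
  then have "((\<lambda>w. C * (1 + (norm w + norm a)) ^ N * norm (w - a)) \<longlongrightarrow> 0) (at a within \<Omega>)"
    by simp
  then have "((\<lambda>w. f w - f a) \<longlongrightarrow> 0) (at a within \<Omega>)"
    by (rule Lim_null_comparison[rotated]) (auto simp: eventually_at_filter bound)
  then show "(f \<longlongrightarrow> f a) (at a within \<Omega>)"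
    by (simp add: LIM_zero_iff)
qed

section \<open>The block definitions in terms of the Euclidean norm\<close>

text \<open>Every block norm is at most \<open>norm w\<close>, so \<open>M = norm w\<close> bounds
  the polynomial by a power. Conversely \<open>norm w\<close> is at most the sum of the block norms,
  so a power is bounded by a positive polynomial in them.\<close>

lemma poly_bounded_iff:
  assumes "block_structure B"
  shows "poly_bounded B \<Omega> \<psi> \<longleftrightarrow> poly_growth \<Omega> \<psi>"
proof
  assume "poly_bounded B \<Omega> \<psi>"
  then obtain S where S: "pos_mpoly (nblocks B) S"
    "\<And>w. w \<in> \<Omega> \<Longrightarrow> norm (\<psi> w) \<le> mpoly_eval S (block_norm B w)"
    unfolding poly_bounded_def by blast
  obtain C N where C: "C \<ge> 0" "\<And>x M. (\<forall>i<nblocks B. 0 \<le> x i \<and> x i \<le> M) \<Longrightarrow> 0 \<le> M \<Longrightarrow>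
      mpoly_eval S x \<le> C * (1 + M) ^ N"
    using mpoly_eval_le_power[OF S(1)] by blast
  have "mpoly_eval S (block_norm B w) \<le> C * (1 + norm w) ^ N" for w
    by (rule C(2)) (auto simp: block_norm_nonneg block_norm_le_norm[OF assms])
  then show "poly_growth \<Omega> \<psi>"
    unfolding poly_growth_def
    by (intro poly_majorI[OF C(1)]) (use S(2) in \<open>auto intro: order_trans\<close>)
next
  assume "poly_growth \<Omega> \<psi>"
  then obtain C N where C: "C \<ge> 0" "\<And>w. w \<in> \<Omega> \<Longrightarrow> norm (\<psi> w) \<le> C * (1 + norm w) ^ N"
    unfolding poly_growth_def poly_major_def by auto
  obtain S where S: "pos_mpoly (nblocks B) S"
    "\<And>x M. (\<forall>i<nblocks B. 0 \<le> x i) \<Longrightarrow> 0 \<le> M \<Longrightarrow> M \<le> 2 * (\<Sum>i<nblocks B. x i) \<Longrightarrow>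
      C * (1 + M) ^ N \<le> mpoly_eval S x"
    using power_le_mpoly_eval[OF C(1)] by blast
  have "C * (1 + norm w) ^ N \<le> mpoly_eval S (block_norm B w)" for w
  proof (rule S(2))
    have "0 \<le> (\<Sum>i<nblocks B. block_norm B w i)" by (simp add: sum_nonneg block_norm_nonneg)
    then show "norm w \<le> 2 * (\<Sum>i<nblocks B. block_norm B w i)"
      using norm_le_sum_block_norm[OF assms, of w] by linarith
  qed (auto simp: block_norm_nonneg)
  then show "poly_bounded B \<Omega> \<psi>"
    unfolding poly_bounded_def using S(1) C(2) by (meson order_trans)
qed

text \<open>Each maximum of block norms is at most \<open>norm w + norm w'\<close>. Conversely
  \<open>norm w\<close> and \<open>norm w'\<close> are each at most the sum of the maxima, so
  together at most twice that sum.\<close>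

lemma poly_gen_continuous_iff:
  assumes "block_structure B"
  shows "poly_gen_continuous B \<Omega> \<psi> \<longleftrightarrow> poly_lipschitz \<Omega> \<psi>"
proof
  assume "poly_gen_continuous B \<Omega> \<psi>"
  then obtain S where S: "pos_mpoly (nblocks B) S"
    "\<And>w w'. w \<in> \<Omega> \<Longrightarrow> w' \<in> \<Omega> \<Longrightarrow> norm (\<psi> w - \<psi> w') \<le>
      mpoly_eval S (\<lambda>i. max (block_norm B w i) (block_norm B w' i)) * norm (w - w')"
    unfolding poly_gen_continuous_def by blast
  obtain C N where C: "C \<ge> 0" "\<And>x M. (\<forall>i<nblocks B. 0 \<le> x i \<and> x i \<le> M) \<Longrightarrow> 0 \<le> M \<Longrightarrow>
      mpoly_eval S x \<le> C * (1 + M) ^ N"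
    using mpoly_eval_le_power[OF S(1)] by blast
  have le: "mpoly_eval S (\<lambda>i. max (block_norm B w i) (block_norm B w' i))
      \<le> C * (1 + (norm w + norm w')) ^ N" for w w'
  proof (rule C(2))
    show "\<forall>i<nblocks B. 0 \<le> max (block_norm B w i) (block_norm B w' i) \<and>
        max (block_norm B w i) (block_norm B w' i) \<le> norm w + norm w'"
      using block_norm_le_norm[OF assms]
      by (auto simp: le_max_iff_disj block_norm_nonneg intro: add_increasing add_increasing2)
  qed simp
  show "poly_lipschitz \<Omega> \<psi>"
  proof (rule poly_lipschitzI)
    show "poly_major (\<Omega> \<times> \<Omega>) (\<lambda>(w, w'). norm w + norm w')
        (\<lambda>(w, w'). C * (1 + (norm w + norm w')) ^ N)"
      by (rule poly_majorI[OF C(1), of _ _ _ N]) (use C(1) in auto)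
    show "norm (\<psi> w - \<psi> w') \<le> (case (w, w') of (w, w') \<Rightarrow> C * (1 + (norm w + norm w')) ^ N) *
        norm (w - w')" if "w \<in> \<Omega>" "w' \<in> \<Omega>" for w w'
      using S(2)[OF that] le[of w w'] by (simp add: order_trans[OF _ mult_right_mono])
  qed
next
  assume "poly_lipschitz \<Omega> \<psi>"
  then obtain L where L: "poly_major (\<Omega> \<times> \<Omega>) (\<lambda>(w, w'). norm w + norm w') L"
    "\<And>w w'. w \<in> \<Omega> \<Longrightarrow> w' \<in> \<Omega> \<Longrightarrow> norm (\<psi> w - \<psi> w') \<le> L (w, w') * norm (w - w')"
    by (rule poly_lipschitzE) blast
  obtain C N where C: "C \<ge> 0"
    "\<And>s. s \<in> \<Omega> \<times> \<Omega> \<Longrightarrow> \<bar>L s\<bar> \<le> C * (1 + (case s of (w, w') \<Rightarrow> norm w + norm w')) ^ N"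
    using L(1) unfolding poly_major_def by blast
  obtain S where S: "pos_mpoly (nblocks B) S"
    "\<And>x M. (\<forall>i<nblocks B. 0 \<le> x i) \<Longrightarrow> 0 \<le> M \<Longrightarrow> M \<le> 2 * (\<Sum>i<nblocks B. x i) \<Longrightarrow>
      C * (1 + M) ^ N \<le> mpoly_eval S x"
    using power_le_mpoly_eval[OF C(1)] by blast
  have "norm (\<psi> w - \<psi> w') \<le>
      mpoly_eval S (\<lambda>i. max (block_norm B w i) (block_norm B w' i)) * norm (w - w')"
    if w: "w \<in> \<Omega>" "w' \<in> \<Omega>" for w w'
  proof -
    let ?x = "\<lambda>i. max (block_norm B w i) (block_norm B w' i)"
    have "norm w \<le> (\<Sum>i<nblocks B. ?x i)" "norm w' \<le> (\<Sum>i<nblocks B. ?x i)"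
      by (rule order_trans[OF norm_le_sum_block_norm[OF assms]], simp add: sum_mono)+
    then have "C * (1 + (norm w + norm w')) ^ N \<le> mpoly_eval S ?x"
      by (intro S(2)) (auto simp: le_max_iff_disj block_norm_nonneg)
    then have "L (w, w') \<le> mpoly_eval S ?x"
      using C(2)[of "(w, w')"] w by auto
    then show ?thesis
      using L(2)[OF w] by (meson mult_right_mono norm_ge_zero order_trans)
  qed
  then show "poly_gen_continuous B \<Omega> \<psi>"
    unfolding poly_gen_continuous_def using S(1) by blast
qed

section \<open>Regularity without reference to blocks\<close>

definition poly_smooth :: "(real ^ 'n::finite) set \<Rightarrow> (real ^ 'n \<Rightarrow> real ^ 'm::finite) \<Rightarrow> bool" where
  "poly_smooth \<Omega> f \<longleftrightarrow> (\<forall>w\<in>\<Omega>. f differentiable (at w)) \<and>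
     poly_growth \<Omega> f \<and> poly_growth \<Omega> (gradient f) \<and>
     poly_lipschitz \<Omega> f \<and> poly_lipschitz \<Omega> (gradient f)"

text \<open>The continuity of the gradient in \<open>C1_on\<close> comes from its Lipschitz
  bound.\<close>

lemma poly_regular_iff:
  assumes "block_structure B"
  shows "poly_regular B \<Omega> \<psi> \<longleftrightarrow> poly_smooth \<Omega> \<psi>"
  unfolding poly_regular_def poly_smooth_def poly_gen_smooth_def C1_on_def
    poly_bounded_iff[OF assms] poly_gen_continuous_iff[OF assms]
  using poly_lipschitz_continuous_on by blast

lemma norm_vectorize: "norm (vectorize A) = norm (A :: real ^ 'd::finite ^ 'm::finite)"
proof -
  have "(\<Sum>p\<in>UNIV. (A $ fst p $ snd p)\<^sup>2) = (\<Sum>i\<in>UNIV. \<Sum>j\<in>UNIV. (A $ i $ j)\<^sup>2)"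
    by (simp add: sum.cartesian_product case_prod_unfold)
  then show ?thesis
    by (simp add: vectorize_def norm_vec_def L2_set_def sum_nonneg)
qed

lemma vectorize_diff: "vectorize (A - A') = vectorize A - vectorize (A' :: real ^ 'd::finite ^ 'm::finite)"
  by (simp add: vectorize_def vec_eq_iff)

text \<open>\<open>vectorize\<close> preserves norms and differences, so the bounds on the
  matrix-valued map are bounds on its vectorization.\<close>

lemma poly_regular_matrix_iff:
  assumes "block_structure B"
  shows "poly_regular_matrix B \<Omega> \<psi> \<longleftrightarrow> poly_smooth \<Omega> (\<lambda>w. vectorize (\<psi> w))"
proof -
  have "poly_bounded B \<Omega> \<psi> \<longleftrightarrow> poly_bounded B \<Omega> (\<lambda>w. vectorize (\<psi> w))"
    by (simp add: poly_bounded_def norm_vectorize)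
  moreover have "poly_gen_continuous B \<Omega> \<psi> \<longleftrightarrow> poly_gen_continuous B \<Omega> (\<lambda>w. vectorize (\<psi> w))"
    by (simp add: poly_gen_continuous_def norm_vectorize flip: vectorize_diff)
  ultimately show ?thesis
    unfolding poly_regular_iff[OF assms, symmetric] poly_regular_matrix_def poly_regular_def by simp
qed

section \<open>Sums, bilinear products and compositions\<close>

lemma gradient_eqI:
  fixes f :: "real ^ 'n::finite \<Rightarrow> real ^ 'm::finite"
  assumes "(f has_derivative D) (at w)"
  shows "gradient f w = matrix D"
  unfolding jacobian_def frechet_derivative_at[OF assms, symmetric] ..

lemma has_derivative_gradient:
  fixes f :: "real ^ 'n::finite \<Rightarrow> real ^ 'm::finite"
  assumes "f differentiable (at w)"
  shows "(f has_derivative (\<lambda>h. gradient f w *v h)) (at w)"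
  using assms by (rule jacobian_works[THEN iffD1])

lemma poly_smooth_subset: "poly_smooth \<Omega> f \<Longrightarrow> \<Omega>' \<subseteq> \<Omega> \<Longrightarrow> poly_smooth \<Omega>' f"
  unfolding poly_smooth_def by (auto elim: poly_growth_subset poly_lipschitz_subset)

lemma poly_smooth_add:
  assumes f: "poly_smooth \<Omega> f" and g: "poly_smooth \<Omega> g"
  shows "poly_smooth \<Omega> (\<lambda>w. f w + g w)"
proof -
  have diff: "f differentiable (at w)" "g differentiable (at w)" if "w \<in> \<Omega>" for w
    using f g that unfolding poly_smooth_def by auto
  have grad: "gradient f w + gradient g w = gradient (\<lambda>w. f w + g w) w" if "w \<in> \<Omega>" for w
    unfolding gradient_eqI[OF has_derivative_add[OF diff[OF that, THEN has_derivative_gradient]]]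
      matrix_vector_mult_add_rdistrib[symmetric] by (rule matrix_of_matrix_vector_mul[symmetric])
  note prems = f[unfolded poly_smooth_def] g[unfolded poly_smooth_def]
  have "poly_growth \<Omega> (gradient (\<lambda>w. f w + g w))"
    by (rule poly_growth_cong[OF poly_growth_add grad]) (use prems in auto)
  moreover have "poly_lipschitz \<Omega> (gradient (\<lambda>w. f w + g w))"
    by (rule poly_lipschitz_cong[OF poly_lipschitz_add grad]) (use prems in auto)
  ultimately show ?thesis
    using prems diff unfolding poly_smooth_def by (simp add: poly_growth_add poly_lipschitz_add)
qed

text \<open>In the product rule for \<open>b (f w) (g w)\<close>, one part of the Jacobian has this
  form with \<open>u = f w\<close> and \<open>A\<close> the gradient of \<open>g\<close>.
  Bilinearity suffices, as the spaces are finite-dimensional.\<close>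

lemma bounded_bilinear_matrix_right:
  fixes b :: "real ^ 'p::finite \<Rightarrow> real ^ 'q::finite \<Rightarrow> real ^ 'r::finite"
  assumes "bounded_bilinear b"
  shows "bounded_bilinear (\<lambda>u (A :: real ^ 'n::finite ^ 'q). matrix (\<lambda>h. b u (A *v h)))"
proof -
  interpret bounded_bilinear b by (rule assms)
  have "bilinear (\<lambda>u (A :: real ^ 'n ^ 'q). matrix (\<lambda>h. b u (A *v h)))"
    unfolding bilinear_def
    by (auto intro!: linearI simp: matrix_def vec_eq_iff add_left add_right scaleR_left scaleR_right
        matrix_vector_mult_add_rdistrib scaleR_matrix_vector_assoc[symmetric])
  then show ?thesis by (simp add: bilinear_conv_bounded_bilinear)
qed

text \<open>The other part of the product rule, obtained by exchanging the arguments of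
  \<open>b\<close> and exchanging back.\<close>

lemma bounded_bilinear_matrix_left:
  fixes b :: "real ^ 'p::finite \<Rightarrow> real ^ 'q::finite \<Rightarrow> real ^ 'r::finite"
  assumes "bounded_bilinear b"
  shows "bounded_bilinear (\<lambda>(A :: real ^ 'n::finite ^ 'p) v. matrix (\<lambda>h. b (A *v h) v))"
  using bounded_bilinear.flip[OF bounded_bilinear_matrix_right[OF bounded_bilinear.flip[OF assms]]] .

text \<open>By the product rule the gradient is a sum of two bounded bilinear expressions, each
  pairing one map with the gradient of the other, so the stability results apply to it too.\<close>

lemma poly_smooth_bilinear:
  fixes b :: "real ^ 'p::finite \<Rightarrow> real ^ 'q::finite \<Rightarrow> real ^ 'r::finite"
    and \<Omega> :: "(real ^ 'n::finite) set"
  assumes b: "bounded_bilinear b" and f: "poly_smooth \<Omega> f" and g: "poly_smooth \<Omega> g"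
  shows "poly_smooth \<Omega> (\<lambda>w. b (f w) (g w))"
proof -
  interpret bounded_bilinear b by (rule b)
  let ?grad = "\<lambda>w. matrix (\<lambda>h. b (f w) (gradient g w *v h)) + matrix (\<lambda>h. b (gradient f w *v h) (g w))"
  have deriv: "((\<lambda>w. b (f w) (g w)) has_derivative
      (\<lambda>h. b (f w) (gradient g w *v h) + b (gradient f w *v h) (g w))) (at w)" if "w \<in> \<Omega>" for w
    using f g that unfolding poly_smooth_def by (intro FDERIV has_derivative_gradient) auto
  have grad: "?grad w = gradient (\<lambda>w. b (f w) (g w)) w" if "w \<in> \<Omega>" for w
    unfolding gradient_eqI[OF deriv[OF that]] by (simp add: matrix_def vec_eq_iff)
  note prems = f[unfolded poly_smooth_def] g[unfolded poly_smooth_def]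
  have grow: "poly_growth \<Omega> ?grad"
    by (intro poly_growth_add poly_growth_bilinear[OF bounded_bilinear_matrix_right[OF b]]
        poly_growth_bilinear[OF bounded_bilinear_matrix_left[OF b]]) (use prems in auto)
  have lip: "poly_lipschitz \<Omega> ?grad"
    by (intro poly_lipschitz_add poly_lipschitz_bilinear[OF bounded_bilinear_matrix_right[OF b]]
        poly_lipschitz_bilinear[OF bounded_bilinear_matrix_left[OF b]]) (use prems in auto)
  have "poly_growth \<Omega> (gradient (\<lambda>w. b (f w) (g w)))"
    by (rule poly_growth_cong[OF grow grad])
  moreover have "poly_lipschitz \<Omega> (gradient (\<lambda>w. b (f w) (g w)))"
    by (rule poly_lipschitz_cong[OF lip grad])
  moreover have "(\<lambda>w. b (f w) (g w)) differentiable (at w)" if "w \<in> \<Omega>" for w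
    using deriv[OF that] by (rule differentiableI)
  ultimately show ?thesis
    using prems unfolding poly_smooth_def
    by (simp add: poly_growth_bilinear[OF b] poly_lipschitz_bilinear[OF b])
qed

lemma bounded_bilinear_matrix_mult:
  "bounded_bilinear ((**) :: real ^ 'd::finite ^ 'm::finite \<Rightarrow> real ^ 'n::finite ^ 'd \<Rightarrow> real ^ 'n ^ 'm)"
proof -
  have "bilinear ((**) :: real ^ 'd ^ 'm \<Rightarrow> real ^ 'n ^ 'd \<Rightarrow> real ^ 'n ^ 'm)"
    unfolding bilinear_def
    by (auto intro!: linearI simp: matrix_matrix_mult_def vec_eq_iff distrib_left distrib_right
        sum.distrib sum_distrib_left mult_ac)
  then show ?thesis by (simp add: bilinear_conv_bounded_bilinear)
qed

text \<open>By the chain rule the gradient is the matrix product of the gradient of \<open>f\<close>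
  composed with \<open>g\<close> and the gradient of \<open>g\<close>: one composition followed by
  one bilinear map.\<close>

lemma poly_smooth_compose:
  assumes f: "poly_smooth \<Omega> f" and g: "poly_smooth \<Omega>' g" and sub: "g ` \<Omega>' \<subseteq> \<Omega>"
  shows "poly_smooth \<Omega>' (\<lambda>w. f (g w))"
proof -
  have deriv: "((\<lambda>w. f (g w)) has_derivative (\<lambda>h. gradient f (g w) *v (gradient g w *v h))) (at w)"
    if "w \<in> \<Omega>'" for w
    using f g sub that unfolding poly_smooth_def
    by (intro has_derivative_compose[of g _ w UNIV f] has_derivative_gradient) auto
  have grad: "gradient f (g w) ** gradient g w = gradient (\<lambda>w. f (g w)) w" if "w \<in> \<Omega>'" for w
    unfolding gradient_eqI[OF deriv[OF that]] by (simp add: matrix_vector_mul_assoc)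
  note prems = f[unfolded poly_smooth_def] g[unfolded poly_smooth_def] sub
  have grow: "poly_growth \<Omega>' (\<lambda>w. gradient f (g w))"
    by (rule poly_growth_compose) (use prems in auto)
  have lip: "poly_lipschitz \<Omega>' (\<lambda>w. gradient f (g w))"
    by (rule poly_lipschitz_compose) (use prems in auto)
  have "poly_growth \<Omega>' (gradient (\<lambda>w. f (g w)))"
    by (rule poly_growth_cong[OF poly_growth_bilinear[OF bounded_bilinear_matrix_mult grow] grad])
      (use prems in auto)
  moreover have "poly_lipschitz \<Omega>' (gradient (\<lambda>w. f (g w)))"
    by (rule poly_lipschitz_cong[OF
          poly_lipschitz_bilinear[OF bounded_bilinear_matrix_mult grow _ lip] grad])
      (use prems in auto)
  moreover have "(\<lambda>w. f (g w)) differentiable (at w)" if "w \<in> \<Omega>'" for w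
    using deriv[OF that] by (rule differentiableI)
  moreover have "poly_growth \<Omega>' (\<lambda>w. f (g w))"
    by (rule poly_growth_compose) (use prems in auto)
  moreover have "poly_lipschitz \<Omega>' (\<lambda>w. f (g w))"
    by (rule poly_lipschitz_compose) (use prems in auto)
  ultimately show ?thesis unfolding poly_smooth_def by blast
qed

section \<open>The matrix product on vectorized matrices\<close>

definition unvectorize :: "'a ^ ('m::finite \<times> 'd::finite) \<Rightarrow> 'a ^ 'd ^ 'm" where
  "unvectorize v = (\<chi> i j. v $ (i, j))"

lemma unvectorize_vectorize: "unvectorize (vectorize A) = A"
  by (simp add: unvectorize_def vectorize_def)

text \<open>Gradients are defined for vector-valued maps, so the product is recast as a bilinear map
  between coordinate vectors, to which \<open>poly_smooth_bilinear\<close> applies.\<close>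

lemma bounded_bilinear_vectorized_matrix_mult:
  "bounded_bilinear (\<lambda>(u :: real ^ ('m::finite \<times> 'd::finite)) (v :: real ^ ('d \<times> 'n::finite)).
    vectorize (unvectorize u ** unvectorize v))"
proof -
  have "bilinear (\<lambda>(u :: real ^ ('m \<times> 'd)) (v :: real ^ ('d \<times> 'n)).
      vectorize (unvectorize u ** unvectorize v))"
    unfolding bilinear_def
    by (auto intro!: linearI simp: vectorize_def unvectorize_def matrix_matrix_mult_def vec_eq_iff
        distrib_left distrib_right sum.distrib sum_distrib_left mult_ac)
  then show ?thesis by (simp add: bilinear_conv_bounded_bilinear)
qed

lemma poly_smooth_matrix_mult:
  assumes "poly_smooth \<Omega> (\<lambda>w. vectorize (\<psi> w))" "poly_smooth \<Omega> (\<lambda>w. vectorize (\<psi>' w))"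
  shows "poly_smooth \<Omega> (\<lambda>w. vectorize (\<psi> w ** \<psi>' w))"
  using poly_smooth_bilinear[OF bounded_bilinear_vectorized_matrix_mult assms]
  by (simp add: unvectorize_vectorize)

theorem proposition1:
  shows
    "(\<forall>(B :: 'd1::finite blocks) \<Omega> \<Omega>' (\<psi> :: real ^ 'd1 \<Rightarrow> real ^ 'm1::finite) \<psi>'.
        block_structure B \<longrightarrow> poly_regular B \<Omega> \<psi> \<longrightarrow> poly_regular B \<Omega>' \<psi>' \<longrightarrow>
        poly_regular B (\<Omega> \<inter> \<Omega>') (\<lambda>w. \<psi> w + \<psi>' w))
     \<and>
     (\<forall>(B :: 'k2::finite blocks) \<Omega> \<Omega>' (\<psi> :: real ^ 'k2 \<Rightarrow> real ^ 'd2::finite ^ 'm2::finite)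
        (\<psi>' :: real ^ 'k2 \<Rightarrow> real ^ 'n2::finite ^ 'd2).
        block_structure B \<longrightarrow> poly_regular_matrix B \<Omega> \<psi> \<longrightarrow> poly_regular_matrix B \<Omega>' \<psi>' \<longrightarrow>
        poly_regular_matrix B (\<Omega> \<inter> \<Omega>') (\<lambda>w. \<psi> w ** \<psi>' w))
     \<and>
     (\<forall>(B :: 'd3::finite blocks) (B' :: 'n3::finite blocks) \<Omega> \<Omega>'
        (\<psi> :: real ^ 'd3 \<Rightarrow> real ^ 'm3::finite) (\<psi>' :: real ^ 'n3 \<Rightarrow> real ^ 'd3).
        block_structure B \<longrightarrow> block_structure B' \<longrightarrow>
        poly_regular B \<Omega> \<psi> \<longrightarrow> poly_regular B' \<Omega>' \<psi>' \<longrightarrow>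
        poly_regular B' {w \<in> \<Omega>'. \<psi>' w \<in> \<Omega>} (\<psi> \<circ> \<psi>'))"
proof (intro conjI allI impI)
  fix B :: "'d1 blocks" and \<Omega> \<Omega>' and \<psi> \<psi>' :: "real ^ 'd1 \<Rightarrow> real ^ 'm1"
  assume B: "block_structure B" and "poly_regular B \<Omega> \<psi>" "poly_regular B \<Omega>' \<psi>'"
  then show "poly_regular B (\<Omega> \<inter> \<Omega>') (\<lambda>w. \<psi> w + \<psi>' w)"
    unfolding poly_regular_iff[OF B] by (blast intro: poly_smooth_add poly_smooth_subset)
next
  fix B :: "'k2 blocks" and \<Omega> \<Omega>' and \<psi> :: "real ^ 'k2 \<Rightarrow> real ^ 'd2 ^ 'm2"
    and \<psi>' :: "real ^ 'k2 \<Rightarrow> real ^ 'n2 ^ 'd2"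
  assume B: "block_structure B" and "poly_regular_matrix B \<Omega> \<psi>" "poly_regular_matrix B \<Omega>' \<psi>'"
  then show "poly_regular_matrix B (\<Omega> \<inter> \<Omega>') (\<lambda>w. \<psi> w ** \<psi>' w)"
    unfolding poly_regular_matrix_iff[OF B]
    by (blast intro: poly_smooth_matrix_mult poly_smooth_subset)
next
  fix B :: "'d3 blocks" and B' :: "'n3 blocks" and \<Omega> \<Omega>'
    and \<psi> :: "real ^ 'd3 \<Rightarrow> real ^ 'm3" and \<psi>' :: "real ^ 'n3 \<Rightarrow> real ^ 'd3"
  assume B: "block_structure B" and B': "block_structure B'"
    and "poly_regular B \<Omega> \<psi>" "poly_regular B' \<Omega>' \<psi>'"
  \<comment> \<open>The outer map is measured in the blocks of \<open>B\<close>, the inner one in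
    those of \<open>B'\<close>. Both statements reduce to Euclidean norms, so the two structures
    need not be related.\<close>
  then have "poly_smooth \<Omega> \<psi>" "poly_smooth {w \<in> \<Omega>'. \<psi>' w \<in> \<Omega>} \<psi>'"
    unfolding poly_regular_iff[OF B] poly_regular_iff[OF B'] by (auto elim: poly_smooth_subset)
  then show "poly_regular B' {w \<in> \<Omega>'. \<psi>' w \<in> \<Omega>} (\<psi> \<circ> \<psi>')"
    unfolding poly_regular_iff[OF B'] comp_def by (rule poly_smooth_compose) auto
qed

end
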